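(* Let $(X,d)$ be a rectangular TVS-cone metric space (with values in $E$, with respect to the cone $P$), let $T:X\to X$ be a mapping such that $(X,d)$ is $T$-orbitally complete, and let $\beta$ be a real number with $0<\beta<\frac12$ such that $$d(Tx,Ty)\leq \beta\,[d(x,Tx)+d(y,Ty)]\quad\text{for all } x,y\in X.$$ Then $T$ has a unique fixed point in $X$.
   Context: $E$ is a real Hausdorff locally convex topological vector space. $P\subset E$ is a cone, i.e. a non-empty subset with $P+P\subset P$, $\lambda P\subset P$ for all $\lambda\ge 0$, and $P\cap(-P)=\{0\}$; moreover $P$ is assumed closed with nonempty interior $\operatorname{int}P$ (no normality is assumed). Write $x\le y$ if $y-x\in P$, and $x\ll y$ if $y-x\in \operatorname{int}P$. Rectangular TVS-cone metric space: a nonempty set $X$ with a map $d:X\times X\to E$ such that (RC1) $0\le d(x,y)$ for all $x,y\in X$, and $d(x,y)=0$ if and only if $x=y$; (RC2) $d(x,y)=d(y,x)$ for all $x,y\in X$; (RC3) $d(x,y)\le d(x,z)+d(z,w)+d(w,y)$ for all $x,y\in X$ and all distinct points $z,w\in X$, each of them different from $x$ and $y$. A sequence $\{x_n\}$ in $X$ is Cauchy if for every $c\in E$ with $0\ll c$ there is $n_0\in\mathbb N$ such that $d(x_n,x_{n+m})\ll c$ for all $m,n\in\mathbb N$ with $n\ge n_0$. It converges to $x\in X$ if for every $c\in E$ with $0\ll c$ there is $n_0\in\mathbb N$ such that $d(x_n,x)\ll c$ for all $n\ge n_0$. For $x\in X$ let $\mathbf O(x)=\{x,Tx,T^2x,T^3x,\dots\}$.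 The space $X$ is $T$-orbitally complete if every Cauchy sequence contained in $\mathbf O(x)$ for some $x\in X$ converges to some point of $X$. *)

theory Defs
  imports "HOL-Analysis.Analysis"
begin

section \<open>Real Hausdorff topological vector spaces\<close>

text \<open>
  Joint continuity of scalar multiplication is stated with product filters, in the style of
  the axiom of \<^class>\<open>topological_monoid_add\<close>. Local convexity is not part of the class (a class
  axiom cannot mention \<^const>\<open>convex\<close>); it is expressed as \<open>locally convex UNIV\<close>, that is, every
  point has a neighbourhood base consisting of convex sets.
\<close>

class real_hausdorff_tvs = real_vector + topological_ab_group_add + t2_space +
  assumes tendsto_scaleR_Pair:
      "LIM p (nhds a \<times>\<^sub>F nhds x). fst p *\<^sub>R snd p :> nhds (a *\<^sub>R x)"

instance real_normed_vector \<subseteq> real_hausdorff_tvs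
proof
  fix a :: real and x :: 'a
  show "LIM p (nhds a \<times>\<^sub>F nhds x). fst p *\<^sub>R snd p :> nhds (a *\<^sub>R x)"
    by (intro tendsto_scaleR filterlim_fst filterlim_snd)
qed

lemma locally_convex_UNIV_normed: "locally convex (UNIV :: 'a::real_normed_vector set)"
  unfolding locally_def
proof (intro allI impI, elim conjE)
  fix W :: "'a set" and x
  assume "openin (top_of_set UNIV) W" "x \<in> W"
  then obtain e where "e > 0" "ball x e \<subseteq> W"
    by (metis open_contains_ball open_openin subtopology_UNIV)
  then show "\<exists>U V. openin (top_of_set UNIV) U \<and> convex V \<and> x \<in> U \<and> U \<subseteq> V \<and> V \<subseteq> W"
    by (intro exI[of _ "ball x e"]) (auto simp flip: open_openin)
qed


section \<open>Cones and the induced relations\<close>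

definition tvs_cone :: "'e::real_hausdorff_tvs set \<Rightarrow> bool" where
  "tvs_cone P \<longleftrightarrow>
     P \<noteq> {} \<and> (\<forall>u\<in>P. \<forall>v\<in>P. u + v \<in> P) \<and> cone P \<and> P \<inter> uminus ` P = {0}"

definition cone_le :: "'e::real_hausdorff_tvs \<Rightarrow> 'e set \<Rightarrow> 'e \<Rightarrow> bool"
    ("(_ \<preceq>\<^bsub>_\<^esub> _)" [51, 0, 51] 50) where
  "u \<preceq>\<^bsub>P\<^esub> v \<longleftrightarrow> v - u \<in> P"

definition cone_ll :: "'e::real_hausdorff_tvs \<Rightarrow> 'e set \<Rightarrow> 'e \<Rightarrow> bool"
    ("(_ \<lless>\<^bsub>_\<^esub> _)" [51, 0, 51] 50) where
  "u \<lless>\<^bsub>P\<^esub> v \<longleftrightarrow> v - u \<in> interior P"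


section \<open>Rectangular TVS-cone metric spaces\<close>

text \<open>
  The underlying set \<open>X\<close> is an explicit carrier; the values of \<open>d\<close> outside \<open>X\<close> are irrelevant.
\<close>

locale rectangular_tvs_cone_metric_space =
  fixes P :: "'e::real_hausdorff_tvs set"
    and X :: "'a set"
    and d :: "'a \<Rightarrow> 'a \<Rightarrow> 'e"
  assumes cone: "tvs_cone P"
    and closed_cone: "closed P"
    and interior_nonempty: "interior P \<noteq> {}"
    and nonempty: "X \<noteq> {}"
    and RC1_nonneg: "\<And>x y. x \<in> X \<Longrightarrow> y \<in> X \<Longrightarrow> 0 \<preceq>\<^bsub>P\<^esub> d x y"
    and RC1_zero: "\<And>x y. x \<in> X \<Longrightarrow> y \<in> X \<Longrightarrow> d x y = 0 \<longleftrightarrow> x = y"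
    and RC2: "\<And>x y. x \<in> X \<Longrightarrow> y \<in> X \<Longrightarrow> d x y = d y x"
    and RC3: "\<And>x y z w. x \<in> X \<Longrightarrow> y \<in> X \<Longrightarrow> z \<in> X \<Longrightarrow> w \<in> X \<Longrightarrow>
                z \<noteq> w \<Longrightarrow> z \<noteq> x \<Longrightarrow> z \<noteq> y \<Longrightarrow> w \<noteq> x \<Longrightarrow> w \<noteq> y \<Longrightarrow>
                d x y \<preceq>\<^bsub>P\<^esub> d x z + d z w + d w y"

definition cone_Cauchy :: "'e::real_hausdorff_tvs set \<Rightarrow> ('a \<Rightarrow> 'a \<Rightarrow> 'e) \<Rightarrow> (nat \<Rightarrow> 'a) \<Rightarrow> bool" where
  "cone_Cauchy P d s \<longleftrightarrow>
     (\<forall>c. 0 \<lless>\<^bsub>P\<^esub> c \<longrightarrow> (\<exists>n0. \<forall>m n. n \<ge> n0 \<longrightarrow> d (s n) (s (n + m)) \<lless>\<^bsub>P\<^esub> c))"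

definition cone_converges ::
    "'e::real_hausdorff_tvs set \<Rightarrow> ('a \<Rightarrow> 'a \<Rightarrow> 'e) \<Rightarrow> (nat \<Rightarrow> 'a) \<Rightarrow> 'a \<Rightarrow> bool" where
  "cone_converges P d s x \<longleftrightarrow>
     (\<forall>c. 0 \<lless>\<^bsub>P\<^esub> c \<longrightarrow> (\<exists>n0. \<forall>n\<ge>n0. d (s n) x \<lless>\<^bsub>P\<^esub> c))"

definition iterates :: "('a \<Rightarrow> 'a) \<Rightarrow> 'a \<Rightarrow> 'a set" where
  "iterates T x = range (\<lambda>k. (T ^^ k) x)"

definition orbitally_complete ::
    "'e::real_hausdorff_tvs set \<Rightarrow> 'a set \<Rightarrow> ('a \<Rightarrow> 'a \<Rightarrow> 'e) \<Rightarrow> ('a \<Rightarrow> 'a) \<Rightarrow> bool" where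
  "orbitally_complete P X d T \<longleftrightarrow>
     (\<forall>x\<in>X. \<forall>s. range s \<subseteq> iterates T x \<and> cone_Cauchy P d s \<longrightarrow>
        (\<exists>z\<in>X. cone_converges P d s z))"

end

theory Submission
  imports Defs
begin

text \<open>
  This is Kannan's fixed point argument. Write \<open>x\<^sub>n = T\<^sup>n x\<close>. Applied to two consecutive iterates, the
  contraction condition gives \<open>(1 - \<beta>) d(x\<^sub>n\<^sub>+\<^sub>1, x\<^sub>n\<^sub>+\<^sub>2) \<le> \<beta> d(x\<^sub>n, x\<^sub>n\<^sub>+\<^sub>1)\<close>, so the steps of an orbit
  decay geometrically with ratio \<open>r = \<beta> / (1 - \<beta>)\<close>, which is less than \<open>1\<close> (lemma \<open>step_le_geometric\<close>). Applied to two
  arbitrary iterates, the same condition bounds their distance by two steps, hence by a multiple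
  of \<open>r\<^sup>n\<close> (lemma \<open>orbit_dist_le\<close>). Thus every orbit is Cauchy, whether or not its points are distinct.

  The rectangular inequality enters only for the limit \<open>z\<close> of an orbit, along the path
  \<open>z, x\<^sub>n, x\<^sub>n\<^sub>+\<^sub>1, T z\<close>. It requires these inner points to be distinct and different from the end
  points. If two iterates coincide, geometric decay forces a step to vanish, so the orbit contains a
  fixed point and nothing remains to be shown. Otherwise the orbit is injective, meets \<open>z\<close> and
  \<open>T z\<close> at most once each, and the inequality holds for all large \<open>n\<close>. It yields that
  \<open>d(z, T z)\<close> is below a fixed multiple of every \<open>c \<ggreater> 0\<close>, and since the cone is closed this means
  \<open>d(z, T z) = 0\<close> (lemma \<open>cone_le_all_multiples_eq_0\<close>).

  Convergence in \<open>E\<close> is used only along real multiples of a fixed vector, where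
  it follows from continuity of scalar multiplication.
\<close>

section \<open>Scalar multiplication and the order of a cone\<close>

lemma tendsto_scaleR_tvs:
  fixes x :: "'e::real_hausdorff_tvs"
  assumes "(f \<longlongrightarrow> a) F" "(g \<longlongrightarrow> x) F"
  shows "((\<lambda>n. f n *\<^sub>R g n) \<longlongrightarrow> a *\<^sub>R x) F"
  using filterlim_compose[OF tendsto_scaleR_Pair filterlim_Pair[OF assms]] by simp

lemma continuous_on_scaleR_const_tvs:
  "continuous_on A (\<lambda>x::'e::real_hausdorff_tvs. t *\<^sub>R x)"
  unfolding continuous_on_def by (auto intro!: tendsto_scaleR_tvs tendsto_intros)

lemma tvs_coneD:
  assumes "tvs_cone P"
  shows tvs_cone_add: "\<And>u v. u \<in> P \<Longrightarrow> v \<in> P \<Longrightarrow> u + v \<in> P"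
    and tvs_cone_scaleR: "\<And>t u. 0 \<le> t \<Longrightarrow> u \<in> P \<Longrightarrow> t *\<^sub>R u \<in> P"
    and tvs_cone_zero: "0 \<in> P"
    and tvs_cone_antisym: "\<And>u. u \<in> P \<Longrightarrow> - u \<in> P \<Longrightarrow> u = 0"
proof -
  show "u + v \<in> P" if "u \<in> P" "v \<in> P" for u v
    using assms that by (auto simp: tvs_cone_def)
  show "t *\<^sub>R u \<in> P" if "0 \<le> t" "u \<in> P" for t u
    using assms that by (auto simp: tvs_cone_def cone_def)
  have P: "P \<inter> uminus ` P = {0}"
    using assms by (auto simp: tvs_cone_def)
  then show "0 \<in> P" by blast
  show "u = 0" if "u \<in> P" "- u \<in> P" for u
  proof -
    have "u \<in> uminus ` P"
      using that(2) by (metis imageI minus_minus)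
    then show ?thesis using P that(1) by blast
  qed
qed

lemma cone_le_refl: "tvs_cone P \<Longrightarrow> u \<preceq>\<^bsub>P\<^esub> u"
  by (simp add: cone_le_def tvs_cone_zero)

lemma cone_le_trans:
  assumes "tvs_cone P" "u \<preceq>\<^bsub>P\<^esub> v" "v \<preceq>\<^bsub>P\<^esub> w"
  shows "u \<preceq>\<^bsub>P\<^esub> w"
  using tvs_cone_add[OF assms(1), of "v - u" "w - v"] assms(2,3) by (simp add: cone_le_def)

lemma cone_le_add_mono:
  assumes "tvs_cone P" "u \<preceq>\<^bsub>P\<^esub> v" "u' \<preceq>\<^bsub>P\<^esub> v'"
  shows "u + u' \<preceq>\<^bsub>P\<^esub> v + v'"
  using tvs_cone_add[OF assms(1), of "v - u" "v' - u'"] assms(2,3)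
  by (simp add: cone_le_def algebra_simps)

lemma cone_le_scaleR_left_mono:
  assumes "tvs_cone P" "0 \<le> t" "u \<preceq>\<^bsub>P\<^esub> v"
  shows "t *\<^sub>R u \<preceq>\<^bsub>P\<^esub> t *\<^sub>R v"
  using tvs_cone_scaleR[OF assms(1,2), of "v - u"] assms(3)
  by (simp add: cone_le_def algebra_simps)

lemma cone_le_scaleR_right_mono:
  assumes "tvs_cone P" "s \<le> t" "0 \<preceq>\<^bsub>P\<^esub> u"
  shows "s *\<^sub>R u \<preceq>\<^bsub>P\<^esub> t *\<^sub>R u"
  using tvs_cone_scaleR[OF assms(1), of "t - s" u] assms(2,3)
  by (simp add: cone_le_def algebra_simps)

lemma cone_le_antisym_zero:
  assumes "tvs_cone P" "0 \<preceq>\<^bsub>P\<^esub> u" "u \<preceq>\<^bsub>P\<^esub> 0"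
  shows "u = 0"
  using tvs_cone_antisym[OF assms(1)] assms(2,3) by (simp add: cone_le_def)

text \<open>
  The right-hand side of the contraction condition contains the steps at both points, one of which
  is often the very distance to be estimated. This lemma removes it.
\<close>

lemma cone_le_absorb:
  assumes "tvs_cone P" "t < 1" "u \<preceq>\<^bsub>P\<^esub> v + t *\<^sub>R u"
  shows "u \<preceq>\<^bsub>P\<^esub> (1 / (1 - t)) *\<^sub>R v"
proof -
  have "(1 - t) *\<^sub>R u \<preceq>\<^bsub>P\<^esub> v"
    using assms(3) by (simp add: cone_le_def algebra_simps)
  from cone_le_scaleR_left_mono[OF assms(1) _ this, of "1 / (1 - t)"] show ?thesis
    using assms(2) by simp
qed

lemma cone_ll_imp_le: "u \<lless>\<^bsub>P\<^esub> v \<Longrightarrow> u \<preceq>\<^bsub>P\<^esub> v"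
  using interior_subset by (auto simp: cone_ll_def cone_le_def)

text \<open>
  The translate by \<open>v - u\<close> of the open set \<open>int P\<close> is an open subset of \<open>P\<close>; it is written as a
  preimage because translations are continuous.
\<close>

lemma cone_le_ll_trans:
  assumes "tvs_cone P" "u \<preceq>\<^bsub>P\<^esub> v" "v \<lless>\<^bsub>P\<^esub> w"
  shows "u \<lless>\<^bsub>P\<^esub> w"
proof -
  let ?S = "(\<lambda>x. x - (v - u)) -` interior P"
  have "open ?S"
    by (intro open_vimage open_interior continuous_intros)
  moreover have "?S \<subseteq> P"
  proof
    fix x assume "x \<in> ?S"
    then have "x - (v - u) \<in> P" using interior_subset by auto
    from tvs_cone_add[OF assms(1) this, of "v - u"] show "x \<in> P"
      using assms(2) by (simp add: cone_le_def)
  qed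
  moreover have "w - u \<in> ?S"
    using assms(3) by (simp add: cone_ll_def)
  ultimately show ?thesis
    unfolding cone_ll_def using interior_maximal by blast
qed

lemma cone_ll_scaleR:
  assumes "tvs_cone P" "0 < t" "0 \<lless>\<^bsub>P\<^esub> c"
  shows "0 \<lless>\<^bsub>P\<^esub> t *\<^sub>R c"
proof -
  let ?S = "(\<lambda>x. (1 / t) *\<^sub>R x) -` interior P"
  have "open ?S"
    by (intro open_vimage open_interior continuous_on_scaleR_const_tvs)
  moreover have "?S \<subseteq> P"
  proof
    fix x assume "x \<in> ?S"
    then have "(1 / t) *\<^sub>R x \<in> P" using interior_subset by auto
    from tvs_cone_scaleR[OF assms(1) _ this, of t] show "x \<in> P"
      using assms(2) by simp
  qed
  moreover have "t *\<^sub>R c \<in> ?S"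
    using assms(2,3) by (simp add: cone_ll_def)
  ultimately have "t *\<^sub>R c \<in> interior P"
    using interior_maximal by blast
  then show ?thesis by (simp add: cone_ll_def)
qed

text \<open>
  The vectors \<open>c - a\<^sub>n v\<close> tend to the interior point \<open>c\<close>, so they end up in the open set \<open>int P\<close>.
\<close>

lemma eventually_scaleR_ll:
  fixes v :: "'e::real_hausdorff_tvs"
  assumes "(a \<longlongrightarrow> 0) F" "0 \<lless>\<^bsub>P\<^esub> c"
  shows "\<forall>\<^sub>F n in F. a n *\<^sub>R v \<lless>\<^bsub>P\<^esub> c"
proof -
  have "((\<lambda>n. c - a n *\<^sub>R v) \<longlongrightarrow> c - 0 *\<^sub>R v) F"
    by (intro tendsto_diff tendsto_const tendsto_scaleR_tvs assms(1))
  then show ?thesis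
    using assms(2) topological_tendstoD[OF _ open_interior, of _ c F P]
    by (simp add: cone_ll_def)
qed

text \<open>
  Letting \<open>c\<close> run through \<open>c\<^sub>0 / n\<close> for one interior point \<open>c\<^sub>0\<close>, the vectors \<open>(K / n) c\<^sub>0 - u\<close> of the
  closed set \<open>P\<close> tend to \<open>- u\<close>.
\<close>

lemma cone_le_all_multiples_eq_0:
  fixes P :: "'e::real_hausdorff_tvs set"
  assumes "tvs_cone P" "closed P" "interior P \<noteq> {}"
    and "0 \<preceq>\<^bsub>P\<^esub> u" and le: "\<And>c. 0 \<lless>\<^bsub>P\<^esub> c \<Longrightarrow> u \<preceq>\<^bsub>P\<^esub> K *\<^sub>R c"
  shows "u = 0"
proof -
  obtain c where c: "0 \<lless>\<^bsub>P\<^esub> c"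
    using assms(3) by (auto simp: cone_ll_def)
  have "(\<lambda>n. (K * (1 / real (Suc n))) *\<^sub>R c - u) \<longlonglongrightarrow> (K * 0) *\<^sub>R c - u"
    by (intro tendsto_diff tendsto_const tendsto_scaleR_tvs tendsto_mult
        LIMSEQ_Suc[OF lim_1_over_n])
  moreover have "(K * (1 / real (Suc n))) *\<^sub>R c - u \<in> P" for n
    using le[OF cone_ll_scaleR[OF assms(1) _ c, of "1 / real (Suc n)"]]
    by (simp add: cone_le_def)
  ultimately have "(K * 0) *\<^sub>R c - u \<in> P"
    by (intro Lim_in_closed_set[OF assms(2)]) auto
  then show ?thesis
    using cone_le_antisym_zero[OF assms(1,4)] by (simp add: cone_le_def)
qed

section \<open>Orbits of a Kannan contraction\<close>

locale kannan_contraction = rectangular_tvs_cone_metric_space P X d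
  for P :: "'e::real_hausdorff_tvs set" and X :: "'a set" and d +
  fixes T :: "'a \<Rightarrow> 'a" and \<beta> :: real
  assumes maps_to: "T \<in> X \<rightarrow> X"
    and beta_pos: "0 < \<beta>" and beta_less: "\<beta> < 1 / 2"
    and contraction: "\<And>x y. x \<in> X \<Longrightarrow> y \<in> X \<Longrightarrow>
           d (T x) (T y) \<preceq>\<^bsub>P\<^esub> \<beta> *\<^sub>R (d x (T x) + d y (T y))"
begin

definition ratio :: real where
  "ratio = \<beta> / (1 - \<beta>)"

lemma ratio_bounds: "0 < ratio" "ratio < 1"
  using beta_pos beta_less by (auto simp: ratio_def)

lemma iterate_in: "x \<in> X \<Longrightarrow> (T ^^ n) x \<in> X"
  using maps_to by (induction n) auto

lemma step_le:
  assumes "x \<in> X"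
  shows "d (T x) (T (T x)) \<preceq>\<^bsub>P\<^esub> ratio *\<^sub>R d x (T x)"
proof -
  have "T x \<in> X" using assms maps_to by auto
  with contraction[OF assms] have
    "d (T x) (T (T x)) \<preceq>\<^bsub>P\<^esub> \<beta> *\<^sub>R d x (T x) + \<beta> *\<^sub>R d (T x) (T (T x))"
    by (simp add: scaleR_add_right)
  from cone_le_absorb[OF cone _ this] show ?thesis
    using beta_less by (simp add: ratio_def)
qed

lemma step_le_geometric:
  assumes "x \<in> X"
  shows "d ((T ^^ n) x) ((T ^^ Suc n) x) \<preceq>\<^bsub>P\<^esub> ratio ^ n *\<^sub>R d x (T x)"
proof (induction n)
  case 0
  show ?case by (simp add: cone_le_refl[OF cone])
next
  case (Suc n)
  from cone_le_scaleR_left_mono[OF cone _ Suc, of ratio] ratio_bounds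
  have "ratio *\<^sub>R d ((T ^^ n) x) ((T ^^ Suc n) x) \<preceq>\<^bsub>P\<^esub> ratio ^ Suc n *\<^sub>R d x (T x)"
    by simp
  from cone_le_trans[OF cone _ this] step_le[OF iterate_in[OF assms, of n]] show ?case
    by simp
qed

text \<open>
  The contraction condition bounds the distance of two iterates by the steps that precede them.
  The index is shifted by one because the starting point itself has no preceding step. The
  factor \<open>2 \<beta>\<close> is at most \<open>1\<close>.
\<close>

lemma orbit_dist_le:
  assumes "x \<in> X"
  shows "d ((T ^^ Suc n) x) ((T ^^ Suc (n + m)) x) \<preceq>\<^bsub>P\<^esub> ratio ^ n *\<^sub>R d x (T x)"
proof -
  let ?u = "d x (T x)"
  have u: "0 \<preceq>\<^bsub>P\<^esub> ?u"
    using RC1_nonneg assms maps_to by auto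
  have "ratio ^ (n + m) *\<^sub>R ?u \<preceq>\<^bsub>P\<^esub> ratio ^ n *\<^sub>R ?u"
    using ratio_bounds by (intro cone_le_scaleR_right_mono[OF cone _ u] power_decreasing) auto
  with step_le_geometric[OF assms, of "n + m"]
  have "d ((T ^^ (n + m)) x) ((T ^^ Suc (n + m)) x) \<preceq>\<^bsub>P\<^esub> ratio ^ n *\<^sub>R ?u"
    by (rule cone_le_trans[OF cone])
  then have "\<beta> *\<^sub>R (d ((T ^^ n) x) ((T ^^ Suc n) x) + d ((T ^^ (n + m)) x) ((T ^^ Suc (n + m)) x))
      \<preceq>\<^bsub>P\<^esub> \<beta> *\<^sub>R (ratio ^ n *\<^sub>R ?u + ratio ^ n *\<^sub>R ?u)"
    using beta_pos
    by (intro cone_le_scaleR_left_mono[OF cone] cone_le_add_mono[OF cone]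
        step_le_geometric[OF assms]) auto
  moreover have "\<beta> *\<^sub>R (ratio ^ n *\<^sub>R ?u + ratio ^ n *\<^sub>R ?u) = (2 * \<beta> * ratio ^ n) *\<^sub>R ?u"
    by (simp flip: scaleR_add_left)
  moreover have "(2 * \<beta> * ratio ^ n) *\<^sub>R ?u \<preceq>\<^bsub>P\<^esub> ratio ^ n *\<^sub>R ?u"
    using ratio_bounds beta_less by (intro cone_le_scaleR_right_mono[OF cone _ u]) simp
  moreover have "d ((T ^^ Suc n) x) ((T ^^ Suc (n + m)) x) \<preceq>\<^bsub>P\<^esub>
      \<beta> *\<^sub>R (d ((T ^^ n) x) ((T ^^ Suc n) x) + d ((T ^^ (n + m)) x) ((T ^^ Suc (n + m)) x))"
    using contraction[OF iterate_in[OF assms, of n] iterate_in[OF assms, of "n + m"]] by simp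
  ultimately show ?thesis
    using cone_le_trans[OF cone] by metis
qed

lemma eventually_geometric_ll:
  assumes "0 \<lless>\<^bsub>P\<^esub> c"
  shows "\<forall>\<^sub>F n in sequentially. ratio ^ n *\<^sub>R v \<lless>\<^bsub>P\<^esub> c"
  using ratio_bounds assms by (intro eventually_scaleR_ll LIMSEQ_realpow_zero) auto

lemma orbit_Cauchy:
  assumes "x \<in> X"
  shows "cone_Cauchy P d (\<lambda>n. (T ^^ Suc n) x)"
  unfolding cone_Cauchy_def
proof (intro allI impI)
  fix c assume "0 \<lless>\<^bsub>P\<^esub> c"
  then obtain N where "\<And>n. n \<ge> N \<Longrightarrow> ratio ^ n *\<^sub>R d x (T x) \<lless>\<^bsub>P\<^esub> c"
    using eventually_geometric_ll unfolding eventually_sequentially by blast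
  then show "\<exists>n0. \<forall>m n. n0 \<le> n \<longrightarrow> d ((T ^^ Suc n) x) ((T ^^ Suc (n + m)) x) \<lless>\<^bsub>P\<^esub> c"
    using cone_le_ll_trans[OF cone orbit_dist_le[OF assms]] by blast
qed

text \<open>
  A point \<open>x\<close> that returns to itself after \<open>k > 0\<close> iterations repeats its first step, so
  \<open>d(x, T x) \<le> r\<^sup>k d(x, T x)\<close> with \<open>r\<^sup>k < 1\<close>.
\<close>

lemma periodic_imp_fixed:
  assumes "x \<in> X" "(T ^^ k) x = x" "0 < k"
  shows "T x = x"
proof -
  have Tx: "T x \<in> X" using assms(1) maps_to by auto
  have "d x (T x) \<preceq>\<^bsub>P\<^esub> 0 + ratio ^ k *\<^sub>R d x (T x)"
    using step_le_geometric[OF assms(1), of k] assms(2) by simp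
  moreover have "ratio ^ k < 1"
    using ratio_bounds assms(3) by (simp add: power_less_one_iff)
  ultimately have "d x (T x) \<preceq>\<^bsub>P\<^esub> 0"
    using cone_le_absorb[OF cone] by fastforce
  then have "d x (T x) = 0"
    using cone_le_antisym_zero[OF cone] RC1_nonneg assms(1) Tx by blast
  then show ?thesis
    using RC1_zero assms(1) Tx by metis
qed

lemma inj_orbit:
  assumes "x \<in> X" and no_fixed: "\<And>y. y \<in> X \<Longrightarrow> T y \<noteq> y"
  shows "inj (\<lambda>n. (T ^^ n) x)"
proof (rule linorder_injI)
  fix i j :: nat assume "i < j"
  then have "(T ^^ j) x = (T ^^ (j - i)) ((T ^^ i) x)"
    by (simp flip: comp_apply[of "T ^^ (j - i)"] funpow_add)
  then show "(T ^^ i) x \<noteq> (T ^^ j) x"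
    using periodic_imp_fixed[OF iterate_in[OF assms(1)], of "j - i" i]
      no_fixed iterate_in[OF assms(1)] \<open>i < j\<close> by auto
qed

section \<open>Fixed points\<close>

text \<open>
  The path \<open>z, y, T y, T z\<close> with its last segment estimated by the contraction condition; the
  resulting term \<open>\<beta> d(z, T z)\<close> is absorbed on the left.
\<close>

lemma dist_image_le:
  assumes "z \<in> X" "y \<in> X" and "T y \<noteq> y"
    and "y \<noteq> z" "y \<noteq> T z" "T y \<noteq> z" "T y \<noteq> T z"
  shows "d z (T z) \<preceq>\<^bsub>P\<^esub> (1 / (1 - \<beta>)) *\<^sub>R (d y z + (1 + \<beta>) *\<^sub>R d y (T y))"
proof -
  have in_X: "T y \<in> X" "T z \<in> X" using assms maps_to by auto
  have "d z (T z) \<preceq>\<^bsub>P\<^esub> d z y + d y (T y) + d (T y) (T z)"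
    using assms in_X by (intro RC3) auto
  moreover have "d z y + d y (T y) + d (T y) (T z) \<preceq>\<^bsub>P\<^esub>
      d z y + d y (T y) + \<beta> *\<^sub>R (d y (T y) + d z (T z))"
    using assms by (intro cone_le_add_mono[OF cone cone_le_refl[OF cone]] contraction)
  ultimately have "d z (T z) \<preceq>\<^bsub>P\<^esub> d z y + d y (T y) + \<beta> *\<^sub>R (d y (T y) + d z (T z))"
    by (rule cone_le_trans[OF cone])
  then have "d z (T z) \<preceq>\<^bsub>P\<^esub> (d y z + (1 + \<beta>) *\<^sub>R d y (T y)) + \<beta> *\<^sub>R d z (T z)"
    using RC2[OF assms(1,2)] by (simp add: algebra_simps)
  then show ?thesis
    using cone_le_absorb[OF cone] beta_less by simp
qed

lemma orbit_limit_fixed: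
  assumes "x \<in> X" "z \<in> X" and conv: "cone_converges P d (\<lambda>n. (T ^^ Suc n) x) z"
    and no_fixed: "\<And>y. y \<in> X \<Longrightarrow> T y \<noteq> y"
  shows "T z = z"
proof -
  let ?x = "\<lambda>n. (T ^^ n) x"
  have inj: "inj ?x" using inj_orbit[OF assms(1) no_fixed] .
  have in_X: "T z \<in> X" using assms maps_to by auto
  have avoid: "\<forall>\<^sub>F n in sequentially. ?x n \<noteq> y" for y
  proof -
    have "finite (?x -` {y})"
      using inj by (intro finite_vimageI) auto
    then show ?thesis
      by (simp add: vimage_def eventually_cofinite flip: cofinite_eq_sequentially)
  qed
  \<comment> \<open>The factor is \<open>1 / (1 - \<beta>)\<close> times \<open>1 + (1 + \<beta>)\<close>: in the bound of \<open>dist_image_le\<close>, both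
    distances are estimated by the same \<open>c\<close>.\<close>
  have "d z (T z) \<preceq>\<^bsub>P\<^esub> ((2 + \<beta>) / (1 - \<beta>)) *\<^sub>R c" if c: "0 \<lless>\<^bsub>P\<^esub> c" for c
  proof -
    have "\<forall>\<^sub>F n in sequentially. d (?x (Suc n)) z \<lless>\<^bsub>P\<^esub> c"
      using conv c unfolding cone_converges_def eventually_sequentially by blast
    moreover have "\<forall>\<^sub>F n in sequentially. ratio ^ Suc n *\<^sub>R d x (T x) \<lless>\<^bsub>P\<^esub> c"
      using eventually_geometric_ll[OF c]
      by (simp only: eventually_sequentially_Suc[of "\<lambda>n. ratio ^ n *\<^sub>R d x (T x) \<lless>\<^bsub>P\<^esub> c"])
    moreover have "\<forall>\<^sub>F n in sequentially. ?x (Suc n) \<noteq> y" for y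
      using avoid[of y] by (simp only: eventually_sequentially_Suc[of "\<lambda>n. ?x n \<noteq> y"])
    moreover have "\<forall>\<^sub>F n in sequentially. ?x (Suc (Suc n)) \<noteq> y" for y
      using avoid[of y]
      by (simp only: eventually_sequentially_Suc[of "\<lambda>n. ?x n \<noteq> y"]
          eventually_sequentially_Suc[of "\<lambda>n. ?x (Suc n) \<noteq> y"])
    ultimately have "\<forall>\<^sub>F n in sequentially.
        d (?x (Suc n)) z \<lless>\<^bsub>P\<^esub> c \<and> ratio ^ Suc n *\<^sub>R d x (T x) \<lless>\<^bsub>P\<^esub> c \<and>
        ?x (Suc n) \<noteq> z \<and> ?x (Suc n) \<noteq> T z \<and> ?x (Suc (Suc n)) \<noteq> z \<and> ?x (Suc (Suc n)) \<noteq> T z"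
      by (intro eventually_conj)
    then obtain n where n:
        "d (?x (Suc n)) z \<lless>\<^bsub>P\<^esub> c" "ratio ^ Suc n *\<^sub>R d x (T x) \<lless>\<^bsub>P\<^esub> c"
        "?x (Suc n) \<noteq> z" "?x (Suc n) \<noteq> T z" "?x (Suc (Suc n)) \<noteq> z" "?x (Suc (Suc n)) \<noteq> T z"
      unfolding eventually_sequentially by blast
    define y where "y = ?x (Suc n)"
    have y: "y \<in> X" unfolding y_def by (rule iterate_in[OF assms(1)])
    have Ty: "T y = ?x (Suc (Suc n))" by (simp add: y_def)
    have dist: "d z (T z) \<preceq>\<^bsub>P\<^esub> (1 / (1 - \<beta>)) *\<^sub>R (d y z + (1 + \<beta>) *\<^sub>R d y (T y))"
      using n(3-) no_fixed[OF y] unfolding Ty[symmetric] y_def[symmetric]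
      by (intro dist_image_le assms(2) y)
    have "d y (T y) \<preceq>\<^bsub>P\<^esub> ratio ^ Suc n *\<^sub>R d x (T x)"
      unfolding Ty unfolding y_def by (rule step_le_geometric[OF assms(1)])
    then have "d y (T y) \<preceq>\<^bsub>P\<^esub> c"
      using cone_ll_imp_le[OF n(2)] by (rule cone_le_trans[OF cone])
    moreover have "d y z \<preceq>\<^bsub>P\<^esub> c"
      unfolding y_def using n(1) by (rule cone_ll_imp_le)
    ultimately have "(1 / (1 - \<beta>)) *\<^sub>R (d y z + (1 + \<beta>) *\<^sub>R d y (T y)) \<preceq>\<^bsub>P\<^esub>
        (1 / (1 - \<beta>)) *\<^sub>R (c + (1 + \<beta>) *\<^sub>R c)"
      using beta_pos beta_less
      by (intro cone_le_scaleR_left_mono[OF cone] cone_le_add_mono[OF cone]) auto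
    also have "c + (1 + \<beta>) *\<^sub>R c = (2 + \<beta>) *\<^sub>R c"
      by (simp add: scaleR_add_left flip: scaleR_2)
    finally show ?thesis
      using cone_le_trans[OF cone dist] by simp
  qed
  then have "d z (T z) = 0"
    using cone_le_all_multiples_eq_0[OF cone closed_cone interior_nonempty] RC1_nonneg assms(2) in_X
    by blast
  then show ?thesis
    using RC1_zero assms(2) in_X by metis
qed

lemma fixed_point_exists:
  assumes "orbitally_complete P X d T"
  shows "\<exists>x\<in>X. T x = x"
proof (rule ccontr)
  assume no_fixed: "\<not> ?thesis"
  obtain x where x: "x \<in> X" using nonempty by blast
  have "range (\<lambda>n. (T ^^ Suc n) x) \<subseteq> iterates T x"
    unfolding iterates_def by blast
  with assms x orbit_Cauchy[OF x] obtain z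
    where "z \<in> X" "cone_converges P d (\<lambda>n. (T ^^ Suc n) x) z"
    unfolding orbitally_complete_def by blast
  with orbit_limit_fixed[OF x] no_fixed show False by blast
qed

lemma fixed_point_unique:
  assumes "x \<in> X" "y \<in> X" "T x = x" "T y = y"
  shows "x = y"
proof -
  have "d x x = 0" "d y y = 0"
    using RC1_zero assms(1,2) by auto
  then have "d x y \<preceq>\<^bsub>P\<^esub> 0"
    using contraction[OF assms(1,2)] assms(3,4) by simp
  then have "d x y = 0"
    using cone_le_antisym_zero[OF cone] RC1_nonneg assms(1,2) by blast
  then show ?thesis
    using RC1_zero assms(1,2) by blast
qed

end

theorem theorem2p2:
  fixes P :: "'e::real_hausdorff_tvs set"
    and X :: "'a set"
    and d :: "'a \<Rightarrow> 'a \<Rightarrow> 'e"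
    and T :: "'a \<Rightarrow> 'a"
    and \<beta> :: real
  assumes "locally convex (UNIV :: 'e set)"
    and "rectangular_tvs_cone_metric_space P X d"
    and "T \<in> X \<rightarrow> X"
    and "orbitally_complete P X d T"
    and "0 < \<beta>" and "\<beta> < 1 / 2"
    and "\<And>x y. x \<in> X \<Longrightarrow> y \<in> X \<Longrightarrow>
           d (T x) (T y) \<preceq>\<^bsub>P\<^esub> \<beta> *\<^sub>R (d x (T x) + d y (T y))"
  shows "\<exists>!x. x \<in> X \<and> T x = x"
proof -
  interpret kannan_contraction P X d T \<beta>
    using assms by (intro kannan_contraction.intro kannan_contraction_axioms.intro)
  show ?thesis
    using fixed_point_exists[OF assms(4)] fixed_point_unique by blast
qed

end
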